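(* Let $V:\mathbb{R}^2\to\mathbb{R}$ and consider, for real functions $\alpha,\beta,\gamma,\delta:\mathbb{R}^2\to\mathbb{R}$ of $(x,t)$, the system $$-\hbar\,\partial_t\beta+\frac{\hbar^2}{2m}\left[\partial_x^2\alpha+(\partial_x\alpha)^2-(\partial_x\beta)^2-(\partial_x\gamma)^2+(\partial_x\delta)^2\right]-V=0,$$ $$\partial_t\alpha+\frac{\hbar}{2m}\left[\partial_x^2\beta+2(\partial_x\alpha\,\partial_x\beta-\partial_x\gamma\,\partial_x\delta)\right]=0,$$ $$-\partial_t\delta+\frac{\hbar}{2m}\left[\partial_x^2\gamma+2(\partial_x\alpha\,\partial_x\gamma-\partial_x\beta\,\partial_x\delta)\right]=0,$$ $$\partial_t\gamma+\frac{\hbar}{2m}\left[\partial_x^2\delta+2(\partial_x\alpha\,\partial_x\delta+\partial_x\beta\,\partial_x\gamma)\right]=0.$$ This system possesses an 8-dimensional discrete group, leaving the solution set of the system invariant. The group consists of the following eight transformations $\hat P_0,\dots,\hat P_7$, none of which transforms $\alpha$ and $\beta$: $$\hat P_0=\mathrm{Id},\qquad \hat P_1:\ \gamma\to-\gamma,\ \delta\to-\delta,$$ $$\hat P_2:\ \gamma\to-\delta\,\mathbf{i_2},\ \delta\to\gamma\,\mathbf{i_2},\qquad \hat P_3:\ \gamma\to\delta\,\mathbf{i_2},\ \delta\to-\gamma\,\mathbf{i_2},$$ $$\hat P_4:\ \gamma\to\delta\,\mathbf{i_1},\ \delta\to-\gamma\,\mathbf{i_1},\qquad \hat P_5:\ \gamma\to-\delta\,\mathbf{i_1},\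 \delta\to\gamma\,\mathbf{i_1},$$ $$\hat P_6:\ \gamma\to\gamma\,\mathbf{j},\ \delta\to\delta\,\mathbf{j},\qquad \hat P_7:\ \gamma\to-\gamma\,\mathbf{j},\ \delta\to-\delta\,\mathbf{j}.$$ Moreover: (i) this group of symmetry is abelian, with $\hat P_n^2=\mathrm{Id}$ for $n=0,1,\dots,7$; (ii) $\{\hat P_0,\hat P_1,\hat P_2,\hat P_3\}$ is a subgroup of the symmetry group and is isomorphic to the group $\{\dag_0,\dag_1,\dag_2,\dag_3\}$ of bicomplex conjugations under composition; (iii) $\hat P_4,\hat P_5,\hat P_6,\hat P_7$ act on an arbitrary bicomplex number exactly as $\hat P_0,\hat P_1,\hat P_2,\hat P_3$, respectively, i.e. $\hat P_{n+4}(w)=\hat P_n(w)$ for $n=0,1,2,3$ and all $w\in\mathbb{T}$.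
   Context: The bicomplex numbers are the commutative ring $\mathbb{T}=\{w_0+w_1\mathbf{i_1}+w_2\mathbf{i_2}+w_3\mathbf{j}: w_0,\dots,w_3\in\mathbb{R}\}$ with $\mathbf{i_1}^2=\mathbf{i_2}^2=-1$, $\mathbf{j}^2=1$, $\mathbf{i_1}\mathbf{i_2}=\mathbf{i_2}\mathbf{i_1}=\mathbf{j}$, $\mathbf{i_1}\mathbf{j}=\mathbf{j}\mathbf{i_1}=-\mathbf{i_2}$, $\mathbf{i_2}\mathbf{j}=\mathbf{j}\mathbf{i_2}=-\mathbf{i_1}$. The conjugations of $w=w_0+w_1\mathbf{i_1}+w_2\mathbf{i_2}+w_3\mathbf{j}$ are $w^{\dag_0}=w$, $w^{\dag_1}=w_0-w_1\mathbf{i_1}+w_2\mathbf{i_2}-w_3\mathbf{j}$, $w^{\dag_2}=w_0+w_1\mathbf{i_1}-w_2\mathbf{i_2}-w_3\mathbf{j}$, $w^{\dag_3}=w_0-w_1\mathbf{i_1}-w_2\mathbf{i_2}+w_3\mathbf{j}$. The constants $\hbar$ and $m$ are the reduced Planck constant and the mass. The system is the decomposition of the bicomplex Schrödinger equation $\mathbf{i_1}\hbar\,\partial_t\psi+\frac{\hbar^2}{2m}\partial_x^2\psi-V\psi=0$, $\psi:\mathbb{R}^2\to\mathbb{T}$, for $\psi=\mathrm{e}^{\alpha+\beta\mathbf{i_1}+\gamma\mathbf{i_2}+\delta\mathbf{j}}$ with $\alpha,\beta,\gamma,\delta$ real functions. For a bicomplex number $w=\alpha+\beta\mathbf{i_1}+\gamma\mathbf{i_2}+\delta\mathbf{j}$,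 $\hat P_n(w)$ denotes the bicomplex number obtained by making the substitution $\hat P_n$ for $\gamma$ and $\delta$ in this expression and multiplying out in $\mathbb{T}$. *)

theory Defs
  imports "HOL-Analysis.Analysis" "HOL-Algebra.Bij"
begin

section \<open>Bicomplex numbers\<close>

text \<open>\<open>Bicomplex w0 w1 w2 w3\<close> stands for \<open>w0 + w1 i1 + w2 i2 + w3 j\<close>.\<close>

datatype bicomplex = Bicomplex (bc0: real) (bc1: real) (bc2: real) (bc3: real)

lemma bicomplex_eq_iff:
  "z = w \<longleftrightarrow> bc0 z = bc0 w \<and> bc1 z = bc1 w \<and> bc2 z = bc2 w \<and> bc3 z = bc3 w"
  by (cases z; cases w) simp

instantiation bicomplex :: comm_ring_1
begin

definition "0 = Bicomplex 0 0 0 0"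
definition "1 = Bicomplex 1 0 0 0"
definition "z + w = Bicomplex (bc0 z + bc0 w) (bc1 z + bc1 w) (bc2 z + bc2 w) (bc3 z + bc3 w)"
definition "- z = Bicomplex (- bc0 z) (- bc1 z) (- bc2 z) (- bc3 z)"
definition "z - w = Bicomplex (bc0 z - bc0 w) (bc1 z - bc1 w) (bc2 z - bc2 w) (bc3 z - bc3 w)"

text \<open>The bilinear extension of the multiplication table of \<open>1, i1, i2, j\<close>;
  see \<open>bicomplex_mult_table\<close> below.\<close>

definition "z * w = Bicomplex
  (bc0 z * bc0 w - bc1 z * bc1 w - bc2 z * bc2 w + bc3 z * bc3 w)
  (bc0 z * bc1 w + bc1 z * bc0 w - bc2 z * bc3 w - bc3 z * bc2 w)
  (bc0 z * bc2 w + bc2 z * bc0 w - bc1 z * bc3 w - bc3 z * bc1 w)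
  (bc0 z * bc3 w + bc3 z * bc0 w + bc1 z * bc2 w + bc2 z * bc1 w)"

instance
  by standard
    (auto simp: bicomplex_eq_iff zero_bicomplex_def one_bicomplex_def plus_bicomplex_def
      uminus_bicomplex_def minus_bicomplex_def times_bicomplex_def algebra_simps)

end

lemma bicomplex_sel_simps [simp]:
  "bc0 0 = 0" "bc1 0 = 0" "bc2 0 = 0" "bc3 0 = 0"
  "bc0 1 = 1" "bc1 1 = 0" "bc2 1 = 0" "bc3 1 = 0"
  "bc0 (z + w) = bc0 z + bc0 w" "bc1 (z + w) = bc1 z + bc1 w"
  "bc2 (z + w) = bc2 z + bc2 w" "bc3 (z + w) = bc3 z + bc3 w"
  "bc0 (- z) = - bc0 z" "bc1 (- z) = - bc1 z" "bc2 (- z) = - bc2 z" "bc3 (- z) = - bc3 z"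
  "bc0 (z - w) = bc0 z - bc0 w" "bc1 (z - w) = bc1 z - bc1 w"
  "bc2 (z - w) = bc2 z - bc2 w" "bc3 (z - w) = bc3 z - bc3 w"
  "bc0 (z * w) = bc0 z * bc0 w - bc1 z * bc1 w - bc2 z * bc2 w + bc3 z * bc3 w"
  "bc1 (z * w) = bc0 z * bc1 w + bc1 z * bc0 w - bc2 z * bc3 w - bc3 z * bc2 w"
  "bc2 (z * w) = bc0 z * bc2 w + bc2 z * bc0 w - bc1 z * bc3 w - bc3 z * bc1 w"
  "bc3 (z * w) = bc0 z * bc3 w + bc3 z * bc0 w + bc1 z * bc2 w + bc2 z * bc1 w"
  by (simp_all add: zero_bicomplex_def one_bicomplex_def plus_bicomplex_def
      uminus_bicomplex_def minus_bicomplex_def times_bicomplex_def)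

instantiation bicomplex :: real_algebra_1
begin

definition "r *\<^sub>R z = Bicomplex (r * bc0 z) (r * bc1 z) (r * bc2 z) (r * bc3 z)"

instance
  by standard (auto simp: bicomplex_eq_iff scaleR_bicomplex_def algebra_simps)

end

lemma bicomplex_scaleR_sel [simp]:
  "bc0 (r *\<^sub>R z) = r * bc0 z" "bc1 (r *\<^sub>R z) = r * bc1 z"
  "bc2 (r *\<^sub>R z) = r * bc2 z" "bc3 (r *\<^sub>R z) = r * bc3 z"
  by (simp_all add: scaleR_bicomplex_def)

text \<open>The topology, needed for derivatives of bicomplex-valued functions, is that of the
  Euclidean norm on \<open>\<real>\<^sup>4\<close>.\<close>

instantiation bicomplex :: real_inner
begin

definition inner_bicomplex :: "bicomplex \<Rightarrow> bicomplex \<Rightarrow> real" where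
  "inner_bicomplex z w = bc0 z * bc0 w + bc1 z * bc1 w + bc2 z * bc2 w + bc3 z * bc3 w"

definition norm_bicomplex :: "bicomplex \<Rightarrow> real" where
  "norm_bicomplex z = sqrt (inner z z)"

definition dist_bicomplex :: "bicomplex \<Rightarrow> bicomplex \<Rightarrow> real" where
  "dist_bicomplex z w = norm (z - w)"

definition sgn_bicomplex :: "bicomplex \<Rightarrow> bicomplex" where
  "sgn_bicomplex z = z /\<^sub>R norm z"

definition uniformity_bicomplex :: "(bicomplex \<times> bicomplex) filter" where
  "uniformity_bicomplex = (INF e\<in>{0 <..}. principal {(z, w). dist z w < e})"

definition open_bicomplex :: "bicomplex set \<Rightarrow> bool" where
  "open_bicomplex U \<longleftrightarrow> (\<forall>z\<in>U. eventually (\<lambda>(z', w). z' = z \<longrightarrow> w \<in> U) uniformity)"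

instance
proof
  fix x y z :: bicomplex and r :: real and U :: "bicomplex set"
  show "dist x y = norm (x - y)" by (rule dist_bicomplex_def)
  show "sgn x = x /\<^sub>R norm x" by (rule sgn_bicomplex_def)
  show "uniformity = (INF e\<in>{0 <..}. principal {(z :: bicomplex, w). dist z w < e})"
    by (rule uniformity_bicomplex_def)
  show "open U \<longleftrightarrow> (\<forall>z\<in>U. eventually (\<lambda>(z', w). z' = z \<longrightarrow> w \<in> U) uniformity)"
    by (rule open_bicomplex_def)
  show "inner x y = inner y x" by (simp add: inner_bicomplex_def algebra_simps)
  show "inner (x + y) z = inner x z + inner y z"
    by (simp add: inner_bicomplex_def algebra_simps)
  show "inner (r *\<^sub>R x) y = r * inner x y" by (simp add: inner_bicomplex_def algebra_simps)
  show "0 \<le> inner x x" by (simp add: inner_bicomplex_def)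
  show "inner x x = 0 \<longleftrightarrow> x = 0"
    by (simp add: inner_bicomplex_def bicomplex_eq_iff add_nonneg_eq_0_iff)
  show "norm x = sqrt (inner x x)" by (rule norm_bicomplex_def)
qed

end

definition bi1 :: bicomplex where "bi1 = Bicomplex 0 1 0 0"
definition bi2 :: bicomplex where "bi2 = Bicomplex 0 0 1 0"
definition bj :: bicomplex where "bj = Bicomplex 0 0 0 1"

lemma bicomplex_mult_table:
  "bi1 * bi1 = -1" "bi2 * bi2 = -1" "bj * bj = 1"
  "bi1 * bi2 = bj" "bi2 * bi1 = bj"
  "bi1 * bj = - bi2" "bj * bi1 = - bi2"
  "bi2 * bj = - bi1" "bj * bi2 = - bi1"
  by (simp_all add: bicomplex_eq_iff bi1_def bi2_def bj_def)

lemma Bicomplex_expand: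
  "Bicomplex a b c d = of_real a + of_real b * bi1 + of_real c * bi2 + of_real d * bj"
  by (simp add: bicomplex_eq_iff bi1_def bi2_def bj_def of_real_def)

text \<open>The four conjugations; only the indices 0 to 3 are meaningful.\<close>

definition bconj :: "nat \<Rightarrow> bicomplex \<Rightarrow> bicomplex" where
  "bconj n =
    [\<lambda>w. Bicomplex (bc0 w) (bc1 w) (bc2 w) (bc3 w),
     \<lambda>w. Bicomplex (bc0 w) (- bc1 w) (bc2 w) (- bc3 w),
     \<lambda>w. Bicomplex (bc0 w) (bc1 w) (- bc2 w) (- bc3 w),
     \<lambda>w. Bicomplex (bc0 w) (- bc1 w) (- bc2 w) (bc3 w)] ! n"


section \<open>The system of differential equations\<close>

text \<open>Fields are functions of \<open>(x, t)\<close>. They are polymorphic in the value type because the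
  system is posed for real functions, whereas the transformations with factors
  \<open>i1, i2, j\<close> turn real functions into bicomplex-valued ones.\<close>

definition partial_x :: "(real \<times> real \<Rightarrow> 'a::real_normed_vector) \<Rightarrow> real \<times> real \<Rightarrow> 'a" where
  "partial_x f = (\<lambda>(x, t). vector_derivative (\<lambda>s. f (s, t)) (at x))"

definition partial_t :: "(real \<times> real \<Rightarrow> 'a::real_normed_vector) \<Rightarrow> real \<times> real \<Rightarrow> 'a" where
  "partial_t f = (\<lambda>(x, t). vector_derivative (\<lambda>s. f (x, s)) (at t))"

text \<open>Existence of the derivatives occurring in the system
  (\<open>vector_derivative\<close> has an arbitrary value where the derivative does not exist).\<close>

definition admissible :: "(real \<times> real \<Rightarrow> 'a::real_normed_vector) \<Rightarrow> bool" where
  "admissible f \<longleftrightarrow> (\<forall>x t.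
     (\<lambda>s. f (s, t)) differentiable (at x) \<and>
     (\<lambda>s. partial_x f (s, t)) differentiable (at x) \<and>
     (\<lambda>s. f (x, s)) differentiable (at t))"

definition solves_system ::
    "real \<Rightarrow> real \<Rightarrow> (real \<times> real \<Rightarrow> real) \<Rightarrow>
     (real \<times> real \<Rightarrow> 'a::{real_normed_vector, real_algebra_1, comm_ring_1}) \<Rightarrow>
     (real \<times> real \<Rightarrow> 'a) \<Rightarrow> (real \<times> real \<Rightarrow> 'a) \<Rightarrow> (real \<times> real \<Rightarrow> 'a) \<Rightarrow> bool" where
  "solves_system hbar m V \<alpha> \<beta> \<gamma> \<delta> \<longleftrightarrow>
     admissible \<alpha> \<and> admissible \<beta> \<and> admissible \<gamma> \<and> admissible \<delta> \<and>
     (\<forall>p.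
       - (hbar *\<^sub>R partial_t \<beta> p) + (hbar\<^sup>2 / (2 * m)) *\<^sub>R
           (partial_x (partial_x \<alpha>) p + (partial_x \<alpha> p)\<^sup>2 - (partial_x \<beta> p)\<^sup>2
             - (partial_x \<gamma> p)\<^sup>2 + (partial_x \<delta> p)\<^sup>2)
         - of_real (V p) = 0 \<and>
       partial_t \<alpha> p + (hbar / (2 * m)) *\<^sub>R
           (partial_x (partial_x \<beta>) p
             + 2 * (partial_x \<alpha> p * partial_x \<beta> p - partial_x \<gamma> p * partial_x \<delta> p)) = 0 \<and>
       - partial_t \<delta> p + (hbar / (2 * m)) *\<^sub>R
           (partial_x (partial_x \<gamma>) p
             + 2 * (partial_x \<alpha> p * partial_x \<gamma> p - partial_x \<beta> p * partial_x \<delta> p)) = 0 \<and>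
       partial_t \<gamma> p + (hbar / (2 * m)) *\<^sub>R
           (partial_x (partial_x \<delta>) p
             + 2 * (partial_x \<alpha> p * partial_x \<delta> p + partial_x \<beta> p * partial_x \<gamma> p)) = 0)"


section \<open>The transformations\<close>

type_synonym quadruple = "bicomplex \<times> bicomplex \<times> bicomplex \<times> bicomplex"

type_synonym field_quadruple = "real \<times> real \<Rightarrow> quadruple"

definition solution_set ::
    "real \<Rightarrow> real \<Rightarrow> (real \<times> real \<Rightarrow> real) \<Rightarrow> field_quadruple set" where
  "solution_set hbar m V =
     {\<lambda>p. (\<alpha> p, \<beta> p, \<gamma> p, \<delta> p) | \<alpha> \<beta> \<gamma> \<delta>. solves_system hbar m V \<alpha> \<beta> \<gamma> \<delta>}"

text \<open>The substitutions for \<open>(\<alpha>, \<beta>, \<gamma>, \<delta>)\<close>; only the indices 0 to 7 are meaningful.\<close>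

definition Psubst :: "nat \<Rightarrow> quadruple \<Rightarrow> quadruple" where
  "Psubst n =
    [\<lambda>(\<alpha>, \<beta>, \<gamma>, \<delta>). (\<alpha>, \<beta>, \<gamma>, \<delta>),
     \<lambda>(\<alpha>, \<beta>, \<gamma>, \<delta>). (\<alpha>, \<beta>, - \<gamma>, - \<delta>),
     \<lambda>(\<alpha>, \<beta>, \<gamma>, \<delta>). (\<alpha>, \<beta>, - \<delta> * bi2, \<gamma> * bi2),
     \<lambda>(\<alpha>, \<beta>, \<gamma>, \<delta>). (\<alpha>, \<beta>, \<delta> * bi2, - \<gamma> * bi2),
     \<lambda>(\<alpha>, \<beta>, \<gamma>, \<delta>). (\<alpha>, \<beta>, \<delta> * bi1, - \<gamma> * bi1),
     \<lambda>(\<alpha>, \<beta>, \<gamma>, \<delta>). (\<alpha>, \<beta>, - \<delta> * bi1, \<gamma> * bi1),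
     \<lambda>(\<alpha>, \<beta>, \<gamma>, \<delta>). (\<alpha>, \<beta>, \<gamma> * bj, \<delta> * bj),
     \<lambda>(\<alpha>, \<beta>, \<gamma>, \<delta>). (\<alpha>, \<beta>, - \<gamma> * bj, - \<delta> * bj)] ! n"

definition Phat :: "nat \<Rightarrow> field_quadruple \<Rightarrow> field_quadruple" where
  "Phat n u = (\<lambda>p. Psubst n (u p))"

text \<open>The action on a bicomplex number \<open>\<alpha> + \<beta> i1 + \<gamma> i2 + \<delta> j\<close>: substitute into this
  expression, then multiply out. The number can lose information about the substituted
  quadruple, so this is not injective for every index.\<close>

definition Phat_bc :: "nat \<Rightarrow> bicomplex \<Rightarrow> bicomplex" where
  "Phat_bc n w =
     (case Psubst n (of_real (bc0 w), of_real (bc1 w), of_real (bc2 w), of_real (bc3 w)) of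
        (\<alpha>, \<beta>, \<gamma>, \<delta>) \<Rightarrow> \<alpha> + \<beta> * bi1 + \<gamma> * bi2 + \<delta> * bj)"

text \<open>A set of bijections of a type, as a group under composition once it is known to be
  a subgroup of the group of all bijections.\<close>

definition transf_group :: "('a \<Rightarrow> 'a) set \<Rightarrow> ('a \<Rightarrow> 'a) monoid" where
  "transf_group A = (BijGroup UNIV)\<lparr>carrier := A\<rparr>"

end

(* The transformations and the conjugations compose like bit patterns under exclusive or:
   with the quarter turn J (\<gamma>, \<delta>) = (- \<delta>, \<gamma>) on the last two fields, the
   transformations P_0, ..., P_7 are 1, -1, J i2, - J i2, - J i1, J i1, j, -j, and J^2 = -1.
   The first two equations contain \<gamma> and \<delta> only through
   \<delta>_x^2 - \<gamma>_x^2 and \<gamma>_x \<delta>_x, which all eight preserve; the last two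
   equations are linear in (\<gamma>, \<delta>), and are multiplied by a constant for 1, -1, j, -j,
   and interchanged up to a constant for the others. *)

theory Submission
  imports Defs
begin

unbundle bit_operations_syntax

section \<open>Families of maps composing by exclusive or\<close>

lemma carrier_BijGroup_UNIV: "carrier (BijGroup UNIV) = {f. bij f}"
  by (simp add: BijGroup_def Bij_def extensional_def)

lemma one_BijGroup_UNIV: "\<one>\<^bsub>BijGroup UNIV\<^esub> = id"
  by (auto simp: BijGroup_def fun_eq_iff)

lemma mult_BijGroup_UNIV:
  "bij f \<Longrightarrow> bij g \<Longrightarrow> f \<otimes>\<^bsub>BijGroup UNIV\<^esub> g = f \<circ> g"
  by (simp add: BijGroup_def Bij_def extensional_def compose_def fun_eq_iff)

text \<open>The group facts depend only on index arithmetic, so one argument serves transformations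
  and conjugations alike. Since \<open>k XOR k = 0\<close>, every member is an involution.\<close>

locale xor_family =
  fixes F :: "nat \<Rightarrow> 'a \<Rightarrow> 'a" and N :: nat
  assumes F_0: "F 0 = id"
    and F_comp: "\<And>k l. k \<le> N \<Longrightarrow> l \<le> N \<Longrightarrow> F k \<circ> F l = F (k XOR l)"
    and xor_le: "\<And>k l. k \<le> N \<Longrightarrow> l \<le> N \<Longrightarrow> k XOR l \<le> N"
begin

lemma F_self_inverse: "k \<le> N \<Longrightarrow> F k \<circ> F k = id"
  by (simp add: F_comp F_0)

lemma F_F: "k \<le> N \<Longrightarrow> F k (F k x) = x"
  using F_self_inverse by (rule pointfree_idE)

lemma F_bij: "k \<le> N \<Longrightarrow> bij (F k)"
  using F_self_inverse o_bij by blast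

lemma F_mult: "k \<le> N \<Longrightarrow> l \<le> N \<Longrightarrow> F k \<otimes>\<^bsub>BijGroup UNIV\<^esub> F l = F (k XOR l)"
  by (simp add: mult_BijGroup_UNIV F_bij F_comp)

lemma F_subgroup: "subgroup (F ` {0..N}) (BijGroup UNIV)"
proof -
  interpret B: group "BijGroup (UNIV :: 'a set)" by (rule group_BijGroup)
  show ?thesis
  proof (rule B.subgroupI)
    show "F ` {0..N} \<subseteq> carrier (BijGroup UNIV)"
      by (auto simp: carrier_BijGroup_UNIV F_bij)
    show "F ` {0..N} \<noteq> {}" by simp
    fix f assume "f \<in> F ` {0..N}"
    then obtain k where k: "k \<le> N" "f = F k" by auto
    then have "f \<otimes>\<^bsub>BijGroup UNIV\<^esub> f = \<one>\<^bsub>BijGroup UNIV\<^esub>"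
      by (simp add: F_mult F_0 one_BijGroup_UNIV)
    then have "inv\<^bsub>BijGroup UNIV\<^esub> f = f"
      using k by (intro B.inv_equality) (auto simp: carrier_BijGroup_UNIV F_bij)
    then show "inv\<^bsub>BijGroup UNIV\<^esub> f \<in> F ` {0..N}"
      using k by auto
    fix g assume "g \<in> F ` {0..N}"
    then show "f \<otimes>\<^bsub>BijGroup UNIV\<^esub> g \<in> F ` {0..N}"
      using k by (auto simp: F_mult xor_le)
  qed
qed

lemma F_comm_group: "comm_group (transf_group (F ` {0..N}))"
proof -
  interpret B: group "BijGroup (UNIV :: 'a set)" by (rule group_BijGroup)
  have "group (transf_group (F ` {0..N}))"
    unfolding transf_group_def by (rule B.subgroup_imp_group[OF F_subgroup])
  then show ?thesis
    by (rule group.group_comm_groupI) (auto simp: transf_group_def F_mult xor.commute)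
qed

end

text \<open>Sending \<open>F k\<close> to \<open>G k\<close> is well defined and bijective by
  injectivity, and multiplicative because both families multiply by XOR of indices.\<close>

lemma xor_family_iso:
  assumes "xor_family F N" and "xor_family G N"
    and F_inj: "inj_on F {0..N}" and G_inj: "inj_on G {0..N}"
  shows "transf_group (F ` {0..N}) \<cong> transf_group (G ` {0..N})"
proof -
  interpret F: xor_family F N by fact
  interpret G: xor_family G N by fact
  define h where "h = G \<circ> the_inv_into {0..N} F"
  have h: "h (F k) = G k" if "k \<le> N" for k
    using that F_inj by (simp add: h_def the_inv_into_f_f)
  have "h \<in> hom (transf_group (F ` {0..N})) (transf_group (G ` {0..N}))"
    by (auto simp: hom_def transf_group_def h F.F_mult G.F_mult F.xor_le)
  moreover have "bij_betw h (F ` {0..N}) (G ` {0..N})"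
    unfolding h_def using F_inj G_inj
    by (intro bij_betw_trans[OF bij_betw_the_inv_into]) (auto simp: bij_betw_def)
  ultimately have "h \<in> iso (transf_group (F ` {0..N})) (transf_group (G ` {0..N}))"
    by (simp add: iso_def transf_group_def)
  then show ?thesis by (rule is_isoI)
qed

section \<open>The transformations and the conjugations\<close>

lemma le_7_cases:
  fixes k :: nat
  assumes "k \<le> 7"
  obtains "k = 0" | "k = 1" | "k = 2" | "k = 3" | "k = 4" | "k = 5" | "k = 6" | "k = 7"
  using assms by linarith

lemma le_3_cases:
  fixes k :: nat
  assumes "k \<le> 3"
  obtains "k = 0" | "k = 1" | "k = 2" | "k = 3"
  using assms by linarith

text \<open>Signs are moved into the constant factor, so that each nontrivial case has the shape
  treated in \<open>solves_system_scale\<close> or \<open>solves_system_rotate\<close>.\<close>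

lemma Psubst_simps:
  "Psubst 0 (a, b, c, d) = (a, b, c, d)"
  "Psubst 1 (a, b, c, d) = (a, b, c * (-1), d * (-1))"
  "Psubst 2 (a, b, c, d) = (a, b, d * (- bi2), c * bi2)"
  "Psubst 3 (a, b, c, d) = (a, b, d * bi2, c * (- bi2))"
  "Psubst 4 (a, b, c, d) = (a, b, d * bi1, c * (- bi1))"
  "Psubst 5 (a, b, c, d) = (a, b, d * (- bi1), c * bi1)"
  "Psubst 6 (a, b, c, d) = (a, b, c * bj, d * bj)"
  "Psubst 7 (a, b, c, d) = (a, b, c * (- bj), d * (- bj))"
  by (simp_all add: Psubst_def)

lemma Psubst_comp:
  assumes "k \<le> 7" "l \<le> 7"
  shows "k XOR l \<le> 7 \<and> Psubst k (Psubst l q) = Psubst (k XOR l) q"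
  using assms
  \<comment> \<open>Index 1 occurs as \<open>Suc 0\<close> after simplification and 3 is folded back
    from successor form, so that the rules for \<open>Psubst\<close> match.\<close>
  by (cases q; cases rule: le_7_cases[OF assms(1)]; cases rule: le_7_cases[OF assms(2)])
    (simp_all add: Psubst_simps[unfolded One_nat_def] mult.assoc bicomplex_mult_table
      flip: numeral_3_eq_3)

interpretation Phat: xor_family Phat 7
proof
  show "Phat 0 = id" by (simp add: Phat_def Psubst_def fun_eq_iff)
qed (use Psubst_comp in \<open>auto simp: Phat_def fun_eq_iff\<close>)

interpretation Phat3: xor_family Phat 3
proof
  fix k l :: nat assume kl: "k \<le> 3" "l \<le> 3"
  then show "Phat k \<circ> Phat l = Phat (k XOR l)" by (simp add: Phat.F_comp)
  show "k XOR l \<le> 3" by (cases rule: le_3_cases[OF kl(1)]; cases rule: le_3_cases[OF kl(2)]) auto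
qed (rule Phat.F_0)

text \<open>The bits of the index tell which units change sign: bit 0 for \<open>bi1\<close>, bit 1
  for \<open>bi2\<close>; their product \<open>bj\<close> takes the product of the signs.\<close>

interpretation bconj: xor_family bconj 3
proof
  show "bconj 0 = id" by (simp add: bconj_def fun_eq_iff)
  fix k l :: nat assume kl: "k \<le> 3" "l \<le> 3"
  show "bconj k \<circ> bconj l = bconj (k XOR l)"
    by (cases rule: le_3_cases[OF kl(1)]; cases rule: le_3_cases[OF kl(2)])
      (auto simp: bconj_def fun_eq_iff)
qed (rule Phat3.xor_le)

lemma Phat_inj: "inj_on Phat {0..7}"
proof (rule inj_onI)
  fix k l :: nat assume *: "k \<in> {0..7}" "l \<in> {0..7}" "Phat k = Phat l"
  \<comment> \<open>The input \<gamma> = 1, \<delta> = 0 has eight distinct images: 1, -1, j, -j in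
    the third entry, or i1, -i1, i2, -i2 in the fourth.\<close>
  from *(3) have "Phat k (\<lambda>_. (0, 0, 1, 0)) (0, 0) = Phat l (\<lambda>_. (0, 0, 1, 0)) (0, 0)"
    by simp
  then show "k = l"
    using *(1,2) unfolding atLeastAtMost_iff
    by (elim conjE le_7_cases)
      (simp_all add: Phat_def Psubst_simps[unfolded One_nat_def] bicomplex_eq_iff bi1_def bi2_def bj_def)
qed

lemma bconj_inj: "inj_on bconj {0..3}"
proof (rule inj_onI)
  fix k l :: nat assume *: "k \<in> {0..3}" "l \<in> {0..3}" "bconj k = bconj l"
  \<comment> \<open>The signs in the image of i1 + i2 reveal both bits of the index.\<close>
  from *(3) have "bconj k (Bicomplex 0 1 1 0) = bconj l (Bicomplex 0 1 1 0)"
    by simp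
  then show "k = l"
    using *(1,2) unfolding atLeastAtMost_iff
    by (elim conjE le_3_cases) (simp_all add: bconj_def)
qed

section \<open>Derivatives of fields under linear maps\<close>

lemma bounded_linear_bc:
  "bounded_linear bc0" "bounded_linear bc1" "bounded_linear bc2" "bounded_linear bc3"
proof -
  have "\<bar>bc0 z\<bar> \<le> norm z" "\<bar>bc1 z\<bar> \<le> norm z" "\<bar>bc2 z\<bar> \<le> norm z" "\<bar>bc3 z\<bar> \<le> norm z" for z
    unfolding norm_bicomplex_def inner_bicomplex_def
    by (rule real_le_rsqrt, simp add: power2_eq_square)+
  then show "bounded_linear bc0" "bounded_linear bc1" "bounded_linear bc2" "bounded_linear bc3"
    by (auto intro!: bounded_linear_intro[where K = 1])
qed

text \<open>The Euclidean norm is not submultiplicative (take the square of 1 + j), so boundedness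
  is read off from an expansion in the coordinates of \<open>z\<close>.\<close>

lemma bounded_linear_bicomplex_mult: "bounded_linear (\<lambda>z :: bicomplex. z * c)"
proof -
  have "(\<lambda>z. z * c) = (\<lambda>z. bc0 z *\<^sub>R c + bc1 z *\<^sub>R (bi1 * c) + bc2 z *\<^sub>R (bi2 * c) + bc3 z *\<^sub>R (bj * c))"
    by (auto simp: bicomplex_eq_iff bi1_def bi2_def bj_def algebra_simps)
  then show ?thesis
    by (simp add: bounded_linear_add bounded_linear_scaleR_const bounded_linear_bc)
qed

lemma bounded_linear_differentiable:
  assumes "bounded_linear L" and "f differentiable (at x)"
  shows "(\<lambda>s. L (f s)) differentiable (at x)"
  using assms bounded_linear.has_derivative unfolding differentiable_def by blast

lemma vector_derivative_bounded_linear: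
  assumes "bounded_linear L" and "f differentiable (at x)"
  shows "vector_derivative (\<lambda>s. L (f s)) (at x) = L (vector_derivative f (at x))"
  by (rule vector_derivative_at[OF bounded_linear.has_vector_derivative[OF assms(1)
    vector_derivative_works[THEN iffD1, OF assms(2)]]])

text \<open>Bounded linear maps commute with derivatives that exist; admissibility supplies the
  existence.\<close>

lemma admissible_bounded_linear:
  assumes L: "bounded_linear L" and f: "admissible f"
  shows "admissible (\<lambda>p. L (f p))"
    and "partial_x (\<lambda>p. L (f p)) = (\<lambda>p. L (partial_x f p))"
    and "partial_t (\<lambda>p. L (f p)) = (\<lambda>p. L (partial_t f p))"
    and "partial_x (\<lambda>p. L (partial_x f p)) = (\<lambda>p. L (partial_x (partial_x f) p))"
proof -
  show x: "partial_x (\<lambda>p. L (f p)) = (\<lambda>p. L (partial_x f p))"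
    using f by (auto simp: admissible_def partial_x_def vector_derivative_bounded_linear[OF L])
  show "partial_t (\<lambda>p. L (f p)) = (\<lambda>p. L (partial_t f p))"
    using f by (auto simp: admissible_def partial_t_def vector_derivative_bounded_linear[OF L])
  show "partial_x (\<lambda>p. L (partial_x f p)) = (\<lambda>p. L (partial_x (partial_x f) p))"
    \<comment> \<open>Only the outer \<open>partial_x\<close> is unfolded, so that the second clause
      of admissibility applies to \<open>partial_x f\<close> as a whole.\<close>
    using f unfolding admissible_def partial_x_def[of "partial_x f"]
      partial_x_def[of "\<lambda>p. L (partial_x f p)"]
    by (auto simp: vector_derivative_bounded_linear[OF L])
  show "admissible (\<lambda>p. L (f p))"
    using f unfolding admissible_def x by (auto intro: bounded_linear_differentiable[OF L])
qed

lemma admissible_of_real_iff: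
  "admissible (\<lambda>p. of_real (f p) :: bicomplex) \<longleftrightarrow> admissible f"
proof
  assume "admissible (\<lambda>p. of_real (f p) :: bicomplex)"
  \<comment> \<open>\<open>bc0\<close> is a bounded linear left inverse of
    \<open>of_real\<close>.\<close>
  from admissible_bounded_linear(1)[OF bounded_linear_bc(1) this] show "admissible f"
    by (simp add: of_real_def)
qed (rule admissible_bounded_linear(1)[OF bounded_linear_of_real])

section \<open>Invariance of the system\<close>

text \<open>Links the real system to the bicomplex solution set: \<open>of_real\<close> is injective
  and commutes with the ring operations and the derivatives, so each bicomplex equation is the image
  of the real one.\<close>

lemma solves_system_of_real_iff:
  fixes \<alpha> \<beta> \<gamma> \<delta> :: "real \<times> real \<Rightarrow> real"
  shows "solves_system hbar m V (\<lambda>p. of_real (\<alpha> p) :: bicomplex) (\<lambda>p. of_real (\<beta> p))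
      (\<lambda>p. of_real (\<gamma> p)) (\<lambda>p. of_real (\<delta> p))
    \<longleftrightarrow> solves_system hbar m V \<alpha> \<beta> \<gamma> \<delta>"
\<comment> \<open>Without admissibility both sides are false.\<close>
proof (cases "admissible \<alpha> \<and> admissible \<beta> \<and> admissible \<gamma> \<and> admissible \<delta>")
  case True
  have of_real_iff: "z = (0 :: bicomplex) \<longleftrightarrow> r = 0" if "z = of_real r" for z r
    using that by simp
  note D = admissible_bounded_linear[OF bounded_linear_of_real]
  show ?thesis
    using True unfolding solves_system_def admissible_of_real_iff
    by (intro conj_cong refl all_cong1 of_real_iff)
      (simp_all only: D scaleR_conv_of_real of_real_eq_id id_apply of_real_add of_real_diff
        of_real_minus of_real_mult of_real_power of_real_numeral)
qed (auto simp: solves_system_def admissible_of_real_iff)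

text \<open>The factor \<open>c * c\<close> disappears from the quadratic terms in the first two
  equations; the last two are multiplied by \<open>c\<close>.\<close>

lemma solves_system_scale:
  fixes c :: bicomplex
  assumes S: "solves_system hbar m V \<alpha> \<beta> \<gamma> \<delta>" and c: "c * c = 1"
  shows "solves_system hbar m V \<alpha> \<beta> (\<lambda>p. \<gamma> p * c) (\<lambda>p. \<delta> p * c)"
proof -
  note D = admissible_bounded_linear[OF bounded_linear_bicomplex_mult]
  have adm: "admissible \<alpha>" "admissible \<beta>" "admissible \<gamma>" "admissible \<delta>"
    using S by (auto simp: solves_system_def)
  have quad: "(a * c) * (b * c) = a * b" for a b
    using c by (metis mult.assoc mult.left_commute mult.right_neutral)
  have eq3: "- (a * c) + r *\<^sub>R (b * c + 2 * (e * (f * c) - g * (h * c)))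
      = (- a + r *\<^sub>R (b + 2 * (e * f - g * h))) * c"
    for a b e f g h :: bicomplex and r
    by (simp add: algebra_simps)
  have eq4: "a * c + r *\<^sub>R (b * c + 2 * (e * (f * c) + g * (h * c)))
      = (a + r *\<^sub>R (b + 2 * (e * f + g * h))) * c"
    for a b e f g h :: bicomplex and r
    by (simp add: algebra_simps)
  show ?thesis
    using S[unfolded solves_system_def power2_eq_square]
    unfolding solves_system_def power2_eq_square
    by (simp only: D adm quad eq3 eq4 mult_zero_left simp_thms)
qed

text \<open>In the first equation the sign from \<open>c * c\<close> undoes the exchange of the two
  squares; in the second it cancels the sign of \<open>- c\<close>. The third becomes the old fourth
  times \<open>c\<close>, the fourth the old third times \<open>- c\<close>.\<close>

lemma solves_system_rotate:
  fixes c :: bicomplex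
  assumes S: "solves_system hbar m V \<alpha> \<beta> \<gamma> \<delta>" and c: "c * c = -1"
  shows "solves_system hbar m V \<alpha> \<beta> (\<lambda>p. \<delta> p * c) (\<lambda>p. \<gamma> p * (- c))"
proof -
  note D = admissible_bounded_linear[OF bounded_linear_bicomplex_mult]
  have adm: "admissible \<alpha>" "admissible \<beta>" "admissible \<gamma>" "admissible \<delta>"
    using S by (auto simp: solves_system_def)
  have quad: "(a * c) * (b * c) = - (a * b)" for a b
    using c by (metis mult.assoc mult.left_commute mult_minus1_right)
  have eq1: "x - (a * c) * (a * c) + (b * (- c)) * (b * (- c)) = x - b * b + a * a" for a b x
    by (simp add: quad)
  have eq2: "(a * c) * (b * (- c)) = b * a" for a b
    by (simp add: quad mult.commute)
  have eq3: "- (a * (- c)) + r *\<^sub>R (b * c + 2 * (e * (f * c) - g * (h * (- c))))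
      = (a + r *\<^sub>R (b + 2 * (e * f + g * h))) * c"
    for a b e f g h :: bicomplex and r
    by (simp add: algebra_simps)
  have eq4: "a * c + r *\<^sub>R (b * (- c) + 2 * (e * (f * (- c)) + g * (h * c)))
      = (- a + r *\<^sub>R (b + 2 * (e * f - g * h))) * (- c)"
    for a b e f g h :: bicomplex and r
    by (simp add: algebra_simps)
  show ?thesis
    using S[unfolded solves_system_def power2_eq_square]
    unfolding solves_system_def power2_eq_square
    by (simp only: D adm eq1 eq2 eq3 eq4 mult_zero_left simp_thms)
qed

section \<open>Invariance of the solution set\<close>

lemma mem_solution_set_iff:
  "(\<lambda>p. (\<alpha> p, \<beta> p, \<gamma> p, \<delta> p)) \<in> solution_set hbar m V
    \<longleftrightarrow> solves_system hbar m V \<alpha> \<beta> \<gamma> \<delta>"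
proof -
  have "\<alpha> = \<alpha>' \<and> \<beta> = \<beta>' \<and> \<gamma> = \<gamma>' \<and> \<delta> = \<delta>'"
    if "(\<lambda>p. (\<alpha> p, \<beta> p, \<gamma> p, \<delta> p)) = (\<lambda>p. (\<alpha>' p, \<beta>' p, \<gamma>' p, \<delta>' p))" for \<alpha>' \<beta>' \<gamma>' \<delta>'
    using that by (simp add: fun_eq_iff)
  then show ?thesis unfolding solution_set_def by blast
qed

lemma Phat_solution_set:
  assumes "k \<le> 7" and "u \<in> solution_set hbar m V"
  shows "Phat k u \<in> solution_set hbar m V"
proof -
  from assms(2) obtain \<alpha> \<beta> \<gamma> \<delta> where u: "u = (\<lambda>p. (\<alpha> p, \<beta> p, \<gamma> p, \<delta> p))"
    and S: "solves_system hbar m V \<alpha> \<beta> \<gamma> \<delta>"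
    unfolding solution_set_def by blast
  show ?thesis
    \<comment> \<open>In this order the facts settle the indices 1, 6, 7 (scaling), 3, 2, 4, 5
      (rotation) and 0.\<close>
    using solves_system_scale[OF S, of "-1"] solves_system_scale[OF S, of bj]
      solves_system_scale[OF S, of "- bj"]
      solves_system_rotate[OF S, of bi2] solves_system_rotate[OF S, of "- bi2"]
      solves_system_rotate[OF S, of bi1] solves_system_rotate[OF S, of "- bi1"] S
    by (cases rule: le_7_cases[OF assms(1)])
      (simp_all only: u Phat_def Psubst_simps mem_solution_set_iff minus_mult_minus minus_minus
        bicomplex_mult_table mult_1_left simp_thms)
qed

lemma Phat_solution_set_iff:
  assumes "k \<le> 7"
  shows "Phat k u \<in> solution_set hbar m V \<longleftrightarrow> u \<in> solution_set hbar m V"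
proof
  assume "Phat k u \<in> solution_set hbar m V"
  then have "Phat k (Phat k u) \<in> solution_set hbar m V"
    by (rule Phat_solution_set[OF assms])
  then show "u \<in> solution_set hbar m V"
    by (simp only: Phat.F_F[OF assms])
qed (rule Phat_solution_set[OF assms])

lemma Phat_image_solution_set:
  assumes "k \<le> 7"
  shows "Phat k ` solution_set hbar m V = solution_set hbar m V"
proof
  show "solution_set hbar m V \<subseteq> Phat k ` solution_set hbar m V"
  proof
    fix u assume "u \<in> solution_set hbar m V"
    moreover have "u = Phat k (Phat k u)"
      by (simp only: Phat.F_F[OF assms])
    ultimately show "u \<in> Phat k ` solution_set hbar m V"
      using Phat_solution_set[OF assms] by blast
  qed
qed (use Phat_solution_set[OF assms] in blast)

text \<open>Index 4 turns \<gamma> i2 + \<delta> j into \<delta> i1 i2 - \<gamma> i1 j, which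
  multiplies out to the same number; the index \<open>k + 4\<close> is
  \<open>k XOR 4\<close>.\<close>

lemma Phat_bc_add_4:
  assumes "k \<le> 3"
  shows "Phat_bc (k + 4) w = Phat_bc k w"
  by (cases rule: le_3_cases[OF assms])
    (simp_all add: Phat_bc_def Psubst_simps[unfolded One_nat_def] bicomplex_mult_table mult.assoc)

theorem mainTheorem2:
  fixes hbar m :: real and V :: "real \<times> real \<Rightarrow> real"
  assumes "hbar > 0" and "m > 0"
  shows
    "subgroup (Phat ` {0..7}) (BijGroup UNIV) \<and>
     card (Phat ` {0..7}) = 8 \<and>
     (\<forall>n\<in>{0..7}. Phat n ` solution_set hbar m V = solution_set hbar m V) \<and>
     (\<forall>n\<in>{0..7}. \<forall>\<alpha> \<beta> \<gamma> \<delta> :: real \<times> real \<Rightarrow> real.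
        solves_system hbar m V \<alpha> \<beta> \<gamma> \<delta> \<longleftrightarrow>
        Phat n (\<lambda>p. (of_real (\<alpha> p), of_real (\<beta> p), of_real (\<gamma> p), of_real (\<delta> p)))
          \<in> solution_set hbar m V) \<and>
     comm_group (transf_group (Phat ` {0..7})) \<and>
     (\<forall>n\<in>{0..7}. Phat n \<circ> Phat n = id) \<and>
     subgroup (Phat ` {0..3}) (transf_group (Phat ` {0..7})) \<and>
     subgroup (bconj ` {0..3}) (BijGroup UNIV) \<and>
     transf_group (Phat ` {0..3}) \<cong> transf_group (bconj ` {0..3}) \<and>
     (\<forall>n\<in>{0..3}. \<forall>w. Phat_bc (n + 4) w = Phat_bc n w)"
proof (intro conjI ballI allI)
  show "subgroup (Phat ` {0..7}) (BijGroup UNIV)" by (rule Phat.F_subgroup)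
  show "card (Phat ` {0..7}) = 8" by (simp add: card_image[OF Phat_inj])
  show "comm_group (transf_group (Phat ` {0..7}))" by (rule Phat.F_comm_group)
  show "subgroup (bconj ` {0..3}) (BijGroup UNIV)" by (rule bconj.F_subgroup)
  show "transf_group (Phat ` {0..3}) \<cong> transf_group (bconj ` {0..3})"
    by (intro xor_family_iso Phat3.xor_family_axioms bconj.xor_family_axioms bconj_inj
      inj_on_subset[OF Phat_inj]) simp
  show "subgroup (Phat ` {0..3}) (transf_group (Phat ` {0..7}))"
    unfolding transf_group_def
    by (intro group.subgroup_incl group_BijGroup Phat3.F_subgroup Phat.F_subgroup image_mono) simp
next
  fix n :: nat and \<alpha> \<beta> \<gamma> \<delta> :: "real \<times> real \<Rightarrow> real"
  assume "n \<in> {0..7}"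
  then show "solves_system hbar m V \<alpha> \<beta> \<gamma> \<delta> \<longleftrightarrow>
      Phat n (\<lambda>p. (of_real (\<alpha> p), of_real (\<beta> p), of_real (\<gamma> p), of_real (\<delta> p)))
        \<in> solution_set hbar m V"
    \<comment> \<open>The transformation is removed first, which leaves embedded real fields, and
      then the embedding.\<close>
    by (simp add: Phat_solution_set_iff mem_solution_set_iff solves_system_of_real_iff)
qed (simp_all add: Phat_image_solution_set Phat.F_self_inverse Phat_bc_add_4)

end
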